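(* Let $\mathcal{C}$ be an induced minor closed and replicable class of finite simple graphs, and let $G$ be a finite simple connected graph. Then $G\in\mathcal{C}$ if and only if $u(G)\in\mathcal{C}$.
   Context: Graph classes are closed under isomorphism. Contracting an edge $uv$ replaces $u,v$ by a new vertex adjacent to every other vertex that was adjacent to $u$ or $v$. An induced minor of a graph is a graph obtained from it by deleting vertices and contracting edges. A class of graphs is induced minor closed if every induced minor of each element of the class also belongs to the class. Two distinct vertices are true twins if they have the same closed neighborhood; adding a true twin to a vertex $v$ means adding a new vertex adjacent to exactly $v$ and all neighbors of $v$. A graph class is replicable if adding true twins to any graph of that class yields another graph of that class. The utter graph $u(G)$ of a graph $G=(V,E)$ has vertex set $V\cup E$ (disjoint union), and two distinct vertices of $u(G)$ are adjacent if and only if the corresponding elements of $G$ are adjacent, incident, or adjacent by contraction. Explicitly: two vertices of $V$ are adjacent in $u(G)$ iff they are adjacent in $G$; a vertex $w\in V$ and an edge $xy\in E$ are adjacent in $u(G)$ iff $w\in\{x,y\}$ or $w$ is adjacent in $G$ to $x$ or $y$; two distinct edges $xy,zt\in E$ are adjacent in $u(G)$ iff they share an endpoint or some edge of $G$ joins a vertex of $\{x,y\}$ to a vertex of $\{z,t\}$. *)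

theory Defs
  imports
    "Graph_Theory.Pair_Digraph"
    "Graph_Theory.Digraph_Component"
    "Graph_Theory.Digraph_Isomorphism"
begin

text \<open>
  A finite simple graph is a \<open>pair_graph\<close>: a finite, loop-free, symmetric digraph without
  parallel arcs. An undirected edge \<open>xy\<close> is thus represented by the two arcs \<open>(x,y)\<close> and
  \<open>(y,x)\<close>. The null graph is a \<open>pair_graph\<close>, but it is not \<open>connected\<close>.
\<close>

abbreviation graph_iso :: "'a pair_pre_digraph \<Rightarrow> 'b pair_pre_digraph \<Rightarrow> bool" where
  "graph_iso G H \<equiv> digraph_iso (with_proj G) (with_proj H)"

definition uedges :: "'a pair_pre_digraph \<Rightarrow> 'a set set" where
  "uedges G = {{x, y} | x y. (x, y) \<in> parcs G}"


subsection \<open>Induced minors\<close>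

definition delete_vertex :: "'a pair_pre_digraph \<Rightarrow> 'a \<Rightarrow> 'a pair_pre_digraph" where
  "delete_vertex G v =
     \<lparr> pverts = pverts G - {v},
       parcs = {(x, y) \<in> parcs G. x \<noteq> v \<and> y \<noteq> v} \<rparr>"

text \<open>
  The edge \<open>uv\<close> is replaced by the vertex \<open>w\<close>; this is meaningful only if \<open>w\<close> is new, which is
  demanded where the operation is used.
\<close>

definition contract_edge :: "'a pair_pre_digraph \<Rightarrow> 'a \<Rightarrow> 'a \<Rightarrow> 'a \<Rightarrow> 'a pair_pre_digraph" where
  "contract_edge G u v w =
     (let N = {x \<in> pverts G - {u, v}. (u, x) \<in> parcs G \<or> (v, x) \<in> parcs G}
      in \<lparr> pverts = insert w (pverts G - {u, v}),
           parcs = {(x, y) \<in> parcs G. x \<notin> {u, v} \<and> y \<notin> {u, v}} \<union> {w} \<times> N \<union> N \<times> {w} \<rparr>)"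

inductive induced_minor :: "'a pair_pre_digraph \<Rightarrow> 'a pair_pre_digraph \<Rightarrow> bool" where
  refl: "induced_minor G G"
| delete: "induced_minor H G \<Longrightarrow> v \<in> pverts H \<Longrightarrow> induced_minor (delete_vertex H v) G"
| contract: "induced_minor H G \<Longrightarrow> (u, v) \<in> parcs H \<Longrightarrow> w \<notin> pverts H \<Longrightarrow>
    induced_minor (contract_edge H u v w) G"


subsection \<open>True twins\<close>

text \<open>As above, \<open>w\<close> is the name of the added vertex and must be new.\<close>

definition add_true_twin :: "'a pair_pre_digraph \<Rightarrow> 'a \<Rightarrow> 'a \<Rightarrow> 'a pair_pre_digraph" where
  "add_true_twin G v w =
     (let N = insert v {x. (v, x) \<in> parcs G}
      in \<lparr> pverts = insert w (pverts G),
           parcs = parcs G \<union> {w} \<times> N \<union> N \<times> {w} \<rparr>)"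


subsection \<open>Graph classes\<close>

text \<open>
  Every finite graph has an isomorphic copy with vertices in \<open>nat\<close>, so an isomorphism-closed class
  of finite graphs is represented by its members on natural numbers, and a finite graph with
  vertices of any type belongs to the class iff its copies on natural numbers do.
\<close>

definition graph_class :: "nat pair_pre_digraph set \<Rightarrow> bool" where
  "graph_class C \<longleftrightarrow>
     (\<forall>G\<in>C. pair_graph G) \<and> (\<forall>G\<in>C. \<forall>H. graph_iso G H \<longrightarrow> H \<in> C)"

definition in_class :: "'a pair_pre_digraph \<Rightarrow> nat pair_pre_digraph set \<Rightarrow> bool" where
  "in_class G C \<longleftrightarrow> (\<exists>H\<in>C. graph_iso G H)"

definition induced_minor_closed :: "nat pair_pre_digraph set \<Rightarrow> bool" where
  "induced_minor_closed C \<longleftrightarrow> (\<forall>G\<in>C. \<forall>H. induced_minor H G \<longrightarrow> H \<in> C)"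

definition replicable :: "nat pair_pre_digraph set \<Rightarrow> bool" where
  "replicable C \<longleftrightarrow>
     (\<forall>G\<in>C. \<forall>v\<in>pverts G. \<forall>w. w \<notin> pverts G \<longrightarrow> add_true_twin G v w \<in> C)"


subsection \<open>The utter graph\<close>

fun utter_adj :: "'a pair_pre_digraph \<Rightarrow> 'a + 'a set \<Rightarrow> 'a + 'a set \<Rightarrow> bool" where
  "utter_adj G (Inl v) (Inl w) \<longleftrightarrow> (v, w) \<in> parcs G"
| "utter_adj G (Inl w) (Inr e) \<longleftrightarrow> w \<in> e \<or> (\<exists>x\<in>e. (w, x) \<in> parcs G)"
| "utter_adj G (Inr e) (Inl w) \<longleftrightarrow> w \<in> e \<or> (\<exists>x\<in>e. (x, w) \<in> parcs G)"
| "utter_adj G (Inr e) (Inr f) \<longleftrightarrow> e \<inter> f \<noteq> {} \<or> (\<exists>x\<in>e. \<exists>y\<in>f. (x, y) \<in> parcs G)"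

definition utter_graph :: "'a pair_pre_digraph \<Rightarrow> ('a + 'a set) pair_pre_digraph" where
  "utter_graph G =
     (let V = pverts G <+> uedges G
      in \<lparr> pverts = V,
           parcs = {(a, b). a \<in> V \<and> b \<in> V \<and> a \<noteq> b \<and> utter_adj G a b} \<rparr>)"

end

theory Submission
  imports Defs
begin

text \<open>
  The graph \<open>G\<close> is obtained from \<open>u(G)\<close> by deleting the vertices that are edges of \<open>G\<close>. Conversely,
  \<open>u(G)\<close> is built from \<open>G\<close> by inserting the edges \<open>xy\<close> one at a time: add a true twin \<open>x'\<close> of \<open>x\<close> and
  a true twin \<open>y'\<close> of \<open>y\<close>, then contract \<open>x'y'\<close>. The resulting vertex is adjacent to the union of the
  closed neighbourhoods of \<open>x\<close> and \<open>y\<close>, and this is exactly how \<open>xy\<close> is attached in \<open>u(G)\<close>, both to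
  the vertices of \<open>G\<close> and to the edges inserted before.
\<close>

section \<open>Isomorphisms as vertex maps\<close>

text \<open>A library isomorphism carries separate maps for vertices, arcs, heads and tails. Between
  graphs of the form \<open>with_proj\<close>, whose arcs are pairs, the vertex map alone determines
  the action on arcs, so everything below can work with a single injective \<open>f\<close>.\<close>

lemma graph_iso_iff:
  assumes "pair_wf_digraph G"
  shows "graph_iso G H \<longleftrightarrow> (\<exists>f. inj_on f (pverts G) \<and> pverts H = f ` pverts G \<and>
           parcs H = map_prod f f ` parcs G)"
proof
  assume "graph_iso G H"
  then obtain hom where hom: "pre_digraph.digraph_isomorphism (with_proj G) hom"
    and H: "with_proj H = app_iso hom (with_proj G)"
    by (auto simp: digraph_iso_def)
  have "iso_arcs hom p = map_prod (iso_verts hom) (iso_verts hom) p" if "p \<in> parcs G" for p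
  proof -
    \<comment> \<open>Both sides of \<open>H\<close> are records: comparing their head and tail
      fields forces the projections of \<open>hom\<close>.\<close>
    have "iso_head hom = snd" "iso_tail hom = fst"
      using H by (auto simp: with_proj_def app_iso_def)
    then show ?thesis
      using hom that by (cases p) (auto simp: pre_digraph.digraph_isomorphism_def prod_eq_iff)
  qed
  then show "\<exists>f. inj_on f (pverts G) \<and> pverts H = f ` pverts G \<and> parcs H = map_prod f f ` parcs G"
    using hom H
    by (intro exI[of _ "iso_verts hom"])
      (auto simp: pre_digraph.digraph_isomorphism_def with_proj_def app_iso_def cong: image_cong)
next
  assume "\<exists>f. inj_on f (pverts G) \<and> pverts H = f ` pverts G \<and> parcs H = map_prod f f ` parcs G"
  then obtain f where f: "inj_on f (pverts G)" "pverts H = f ` pverts G"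
    "parcs H = map_prod f f ` parcs G" by blast
  have sub: "parcs G \<subseteq> pverts G \<times> pverts G"
    using assms by (auto simp: pair_wf_digraph_def)
  have inj: "inj_on (map_prod f f) (parcs G)"
    using map_prod_inj_on[OF f(1) f(1)] sub by (rule inj_on_subset)
  define hom where "hom = \<lparr> iso_verts = f, iso_arcs = map_prod f f, iso_head = snd, iso_tail = fst \<rparr>"
  have "wf_digraph (with_proj G)"
    using assms by (simp add: wf_digraph_wp_iff)
  then have "pre_digraph.digraph_isomorphism (with_proj G) hom"
    using f inj by (auto simp: pre_digraph.digraph_isomorphism_def hom_def)
  moreover have "with_proj H = app_iso hom (with_proj G)"
    using f by (auto simp: with_proj_def app_iso_def hom_def)
  ultimately show "graph_iso G H"
    by (auto simp: digraph_iso_def)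
qed

section \<open>Attaching a vertex to the ends of an edge\<close>

text \<open>The net effect of twinning and contracting, without the two auxiliary twins. It thus
  makes sense over any vertex type with room for \<open>w\<close>, even if no further fresh names
  exist there.\<close>

definition attach :: "'a pair_pre_digraph \<Rightarrow> 'a \<Rightarrow> 'a \<Rightarrow> 'a \<Rightarrow> 'a pair_pre_digraph" where
  "attach G x y w =
     (let N = {z \<in> pverts G. z \<in> {x, y} \<or> (x, z) \<in> parcs G \<or> (y, z) \<in> parcs G}
      in \<lparr> pverts = insert w (pverts G), parcs = parcs G \<union> {w} \<times> N \<union> N \<times> {w} \<rparr>)"

lemma attach_eq_contract_twins:
  assumes "pair_graph G" and xy: "(x, y) \<in> parcs G"
    and new: "a \<notin> pverts G" "b \<notin> pverts G" "a \<noteq> b" "w \<notin> pverts G"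
  shows "contract_edge (add_true_twin (add_true_twin G x a) y b) a b w = attach G x y w"
proof -
  interpret pair_graph G by fact
  have xyV: "x \<in> pverts G" "y \<in> pverts G"
    using xy in_arcsD1 in_arcsD2 by auto
  have old: "(p, q) \<notin> parcs G" "(q, p) \<notin> parcs G" if "p \<notin> pverts G" for p q
    using that in_arcsD1 in_arcsD2 by auto
  note old_ab = old[OF new(1)] old[OF new(2)]
  define K where "K = add_true_twin (add_true_twin G x a) y b"
  have verts: "pverts K - {a, b} = pverts G"
    using new by (auto simp: K_def add_true_twin_def Let_def)
  have arcs: "{(p, q) \<in> parcs K. p \<notin> {a, b} \<and> q \<notin> {a, b}} = parcs G"
    using new old_ab by (auto simp: K_def add_true_twin_def Let_def)
  have nbrs: "(a, z) \<in> parcs K \<or> (b, z) \<in> parcs K \<longleftrightarrow>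
      z \<in> {x, y} \<or> (x, z) \<in> parcs G \<or> (y, z) \<in> parcs G" if "z \<in> pverts G" for z
    using that new xyV old_ab by (auto simp: K_def add_true_twin_def Let_def)
  have "{z \<in> pverts G. (a, z) \<in> parcs K \<or> (b, z) \<in> parcs K} =
      {z \<in> pverts G. z \<in> {x, y} \<or> (x, z) \<in> parcs G \<or> (y, z) \<in> parcs G}"
    using nbrs by blast
  then show ?thesis
    unfolding contract_edge_def attach_def Let_def K_def[symmetric] verts arcs by simp
qed

text \<open>The twins and the contraction are carried out in a copy \<open>H\<close> on the natural
  numbers, where fresh names always exist; the isomorphism is then extended to the new
  vertex.\<close>

lemma in_class_attach:
  assumes C: "graph_class C" "induced_minor_closed C" "replicable C"
    and "in_class G C" "pair_wf_digraph G" "(x, y) \<in> parcs G" "w \<notin> pverts G"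
  shows "in_class (attach G x y w) C"
proof -
  obtain H where H: "H \<in> C" "graph_iso G H"
    using assms(4) by (auto simp: in_class_def)
  then obtain f where f: "inj_on f (pverts G)" "pverts H = f ` pverts G"
    "parcs H = map_prod f f ` parcs G"
    using graph_iso_iff[OF assms(5), of H] by auto
  have sub: "parcs G \<subseteq> pverts G \<times> pverts G"
    using assms(5) by (auto simp: pair_wf_digraph_def)
  have gH: "pair_graph H"
    using C(1) H by (auto simp: graph_class_def)
  interpret H: pair_graph H by (rule gH)
  \<comment> \<open>\<open>a\<close> and \<open>b\<close> will be the twins of \<open>f x\<close>
    and \<open>f y\<close>, and \<open>c\<close> the vertex that replaces both.\<close>
  obtain a where a: "a \<notin> pverts H"
    using ex_new_if_finite[OF infinite_UNIV_nat H.pair_finite_verts] by blast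
  obtain b where b: "b \<notin> insert a (pverts H)"
    using ex_new_if_finite[OF infinite_UNIV_nat] H.pair_finite_verts by (meson finite_insert)
  obtain c where c: "c \<notin> insert a (insert b (pverts H))"
    using ex_new_if_finite[OF infinite_UNIV_nat] H.pair_finite_verts by (meson finite_insert)
  have xy: "x \<in> pverts G" "y \<in> pverts G"
    using sub assms(6) by auto
  have fxy: "(f x, f y) \<in> parcs H" "f x \<in> pverts H" "f y \<in> pverts H"
    using assms(6) f xy by force+
  have "add_true_twin (add_true_twin H (f x) a) (f y) b \<in> C" (is "?K \<in> C")
  proof -
    have "add_true_twin H (f x) a \<in> C"
      using C(3) H a fxy by (auto simp: replicable_def)
    moreover have "f y \<in> pverts (add_true_twin H (f x) a)" "b \<notin> pverts (add_true_twin H (f x) a)"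
      using b fxy by (auto simp: add_true_twin_def Let_def)
    ultimately show ?thesis
      using C(3) unfolding replicable_def by blast
  qed
  moreover have "induced_minor (contract_edge ?K a b c) ?K"
  proof (rule induced_minor.contract[OF induced_minor.refl])
    \<comment> \<open>As \<open>f x\<close> and \<open>f y\<close> are adjacent, \<open>a\<close> is
      already a neighbour of \<open>f y\<close> when \<open>b\<close> is made its twin, so
      \<open>b\<close> is joined to \<open>a\<close>.\<close>
    show "(a, b) \<in> parcs ?K"
      using fxy(1) by (simp add: add_true_twin_def Let_def)
    show "c \<notin> pverts ?K"
      using c by (simp add: add_true_twin_def Let_def)
  qed
  ultimately have "contract_edge ?K a b c \<in> C"
    using C(2) unfolding induced_minor_closed_def by blast
  then have inC: "attach H (f x) (f y) c \<in> C"
    using attach_eq_contract_twins[OF gH fxy(1), of a b c] a b c by simp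
  let ?N = "{z \<in> pverts G. z \<in> {x, y} \<or> (x, z) \<in> parcs G \<or> (y, z) \<in> parcs G}"
  define g where "g = f(w := c)"
  have gf: "g z = f z" if "z \<in> pverts G" for z
    using that assms(7) by (auto simp: g_def)
  have gw: "g w = c" by (simp add: g_def)
  have arcs_iff: "(f u, f v) \<in> parcs H \<longleftrightarrow> (u, v) \<in> parcs G" if "u \<in> pverts G" "v \<in> pverts G" for u v
    using inj_on_image_mem_iff[OF map_prod_inj_on[OF f(1) f(1)] _ sub, of "(u, v)"] that f(3) by simp
  \<comment> \<open>Since \<open>f\<close> preserves and reflects adjacency, it maps the
    neighbourhood prescribed for \<open>w\<close> onto the one prescribed for
    \<open>c\<close>.\<close>
  have "(f u \<in> {f x, f y} \<or> (f x, f u) \<in> parcs H \<or> (f y, f u) \<in> parcs H) =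
      (u \<in> {x, y} \<or> (x, u) \<in> parcs G \<or> (y, u) \<in> parcs G)" if "u \<in> pverts G" for u
    using that xy arcs_iff inj_on_eq_iff[OF f(1)] by simp
  then have "{z \<in> pverts H. z \<in> {f x, f y} \<or> (f x, z) \<in> parcs H \<or> (f y, z) \<in> parcs H} = f ` ?N"
    unfolding f(2) by blast
  also have "f ` ?N = g ` ?N"
    using gf by (intro image_cong) auto
  finally have N: "{z \<in> pverts H. z \<in> {f x, f y} \<or> (f x, z) \<in> parcs H \<or> (f y, z) \<in> parcs H} =
      g ` ?N" .
  have pG: "map_prod f f ` parcs G = map_prod g g ` parcs G"
    using gf sub by (intro image_cong) auto
  have "inj_on g (insert w (pverts G))"
    using f c assms(7) by (auto simp: g_def inj_on_def)
  moreover have "insert c (pverts H) = g ` insert w (pverts G)"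
    using gf gw f(2) by auto
  moreover have "parcs H \<union> {c} \<times> g ` ?N \<union> g ` ?N \<times> {c} =
      map_prod g g ` (parcs G \<union> {w} \<times> ?N \<union> ?N \<times> {w})"
    by (simp only: image_Un map_prod_surj_on[OF HOL.refl HOL.refl] f(3) pG gw image_insert image_empty)
  moreover have "pair_wf_digraph (attach G x y w)"
    using sub by unfold_locales (auto simp: attach_def Let_def)
  ultimately have "graph_iso (attach G x y w) (attach H (f x) (f y) c)"
    unfolding graph_iso_iff[OF \<open>pair_wf_digraph (attach G x y w)\<close>]
    by (intro exI[of _ g]) (simp only: attach_def Let_def N pair_pre_digraph.simps simp_thms)
  then show ?thesis
    using inC by (auto simp: in_class_def)
qed

text \<open>The vertices of \<open>D\<close> are deleted one by one, each deletion being a single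
  induced-minor step from a graph already known to be in the class.\<close>

lemma induced_subgraph_in_class:
  assumes C: "induced_minor_closed C" and H: "H \<in> C"
    and D: "finite D" "D \<subseteq> pverts H"
  shows "\<lparr> pverts = pverts H - D, parcs = parcs H \<inter> (- D) \<times> (- D) \<rparr> \<in> C"
  using D
proof (induction D rule: finite_induct)
  case empty
  show ?case using H by (cases H) simp
next
  case (insert v D)
  let ?K = "\<lparr> pverts = pverts H - D, parcs = parcs H \<inter> (- D) \<times> (- D) \<rparr>"
  have "v \<in> pverts ?K" "?K \<in> C" using insert by auto
  then have "delete_vertex ?K v \<in> C"
    using C induced_minor.delete[OF induced_minor.refl, of v ?K]
    by (simp only: induced_minor_closed_def)
  moreover have "delete_vertex ?K v =
      \<lparr> pverts = pverts H - insert v D, parcs = parcs H \<inter> (- insert v D) \<times> (- insert v D) \<rparr>"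
    by (auto simp: delete_vertex_def)
  ultimately show ?case by simp
qed

section \<open>Partial utter graphs\<close>

text \<open>For \<open>F\<close> contained in \<open>uedges G\<close> this is the subgraph of u(G)
  induced by the vertices and the edges in \<open>F\<close>. It interpolates between a copy of
  \<open>G\<close> and u(G): \<open>F\<close> selects vertices, while adjacency always refers to all
  of \<open>G\<close>.\<close>

definition utter_part :: "'a pair_pre_digraph \<Rightarrow> 'a set set \<Rightarrow> ('a + 'a set) pair_pre_digraph" where
  "utter_part G F =
     \<lparr> pverts = pverts G <+> F,
       parcs = {(a, b). a \<in> pverts G <+> F \<and> b \<in> pverts G <+> F \<and> a \<noteq> b \<and> utter_adj G a b} \<rparr>"

lemma utter_part_uedges: "utter_part G (uedges G) = utter_graph G"
  by (simp add: utter_part_def utter_graph_def Let_def)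

lemma pair_wf_utter_part: "pair_wf_digraph (utter_part G F)"
  by unfold_locales (auto simp: utter_part_def)

lemma utter_adj_sym:
  assumes "pair_graph G" and "utter_adj G a b"
  shows "utter_adj G b a"
proof -
  interpret pair_graph G by fact
  show ?thesis
    using assms(2) by (cases a; cases b) (auto intro: arcs_symmetric)
qed

lemma utter_part_insert:
  assumes "pair_graph G" and xy: "(x, y) \<in> parcs G" and "{x, y} \<notin> F"
  shows "utter_part G (insert {x, y} F) = attach (utter_part G F) (Inl x) (Inl y) (Inr {x, y})"
proof -
  interpret pair_graph G by fact
  have V: "x \<in> pverts G" "y \<in> pverts G"
    using xy in_arcsD1 in_arcsD2 by auto
  \<comment> \<open>The key observation: each adjacency rule for an edge splits into the rules for
    its two ends, whether \<open>a\<close> is a vertex or an edge.\<close>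
  have adj: "utter_adj G (Inr {x, y}) a \<longleftrightarrow>
      a \<in> {Inl x, Inl y} \<or> utter_adj G (Inl x) a \<or> utter_adj G (Inl y) a" for a
    by (cases a) (auto intro: arcs_symmetric)
  have adj': "utter_adj G a (Inr {x, y}) \<longleftrightarrow>
      a \<in> {Inl x, Inl y} \<or> utter_adj G (Inl x) a \<or> utter_adj G (Inl y) a" for a
    using adj utter_adj_sym[OF \<open>pair_graph G\<close>] by blast
  define V where "V = pverts G <+> F"
  have V': "pverts G <+> insert {x, y} F = insert (Inr {x, y}) V"
    by (auto simp: V_def)
  have new: "Inr {x, y} \<notin> V" and xyV: "Inl x \<in> V" "Inl y \<in> V"
    using assms(3) V by (auto simp: V_def)
  show ?thesis
    unfolding utter_part_def attach_def Let_def V' V_def[symmetric] pair_pre_digraph.simps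
      pair_pre_digraph.ext_inject
    using new xyV adj adj' by (auto simp del: utter_adj.simps)
qed

lemma graph_iso_utter_part_empty:
  assumes "pair_graph G"
  shows "graph_iso G (utter_part G {})"
proof -
  interpret pair_graph G by fact
  have wf: "u \<in> pverts G" "v \<in> pverts G" "u \<noteq> v" if "(u, v) \<in> parcs G" for u v
    using that in_arcsD1 in_arcsD2 no_loops' by blast+
  show ?thesis
    unfolding graph_iso_iff[OF pair_wf_digraph_axioms]
    by (intro exI[of _ Inl]) (auto simp: utter_part_def dest: wf)
qed

theorem theorem2p3:
  fixes C :: "nat pair_pre_digraph set" and G :: "'a pair_pre_digraph"
  assumes "graph_class C"
    and "induced_minor_closed C"
    and "replicable C"
    and "pair_graph G"
    and "Digraph_Component.connected (with_proj G)"
  shows "in_class G C \<longleftrightarrow> in_class (utter_graph G) C"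
proof
  interpret pair_graph G by fact
  assume G: "in_class G C"
  have "uedges G = (\<lambda>(x, y). {x, y}) ` parcs G"
    by (auto simp: uedges_def)
  then have fin: "finite (uedges G)"
    using pair_finite_arcs by simp
  \<comment> \<open>Stated for every set \<open>F\<close> of edges so that induction can insert one
    edge at a time.\<close>
  have "in_class (utter_part G F) C" if "F \<subseteq> uedges G" for F
    using finite_subset[OF that fin] that
  proof (induction F rule: finite_induct)
    case empty
    have "graph_iso (utter_part G {}) G"
      using digraph_iso_swap[OF wf_digraph_axioms graph_iso_utter_part_empty[OF assms(4)]] .
    then show ?case
      using G digraph_iso_trans unfolding in_class_def by blast
  next
    case (insert e F)
    then obtain x y where e: "e = {x, y}" "(x, y) \<in> parcs G"
      by (auto simp: uedges_def)
    have "x \<in> pverts G" "y \<in> pverts G" "x \<noteq> y"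
      using e in_arcsD1 in_arcsD2 no_loops' by auto
    then have "(Inl x, Inl y) \<in> parcs (utter_part G F)"
      using e by (auto simp: utter_part_def)
    moreover have "Inr {x, y} \<notin> pverts (utter_part G F)"
      using insert e by (auto simp: utter_part_def)
    ultimately show ?case
      using in_class_attach[OF assms(1-3) _ pair_wf_utter_part] utter_part_insert[OF assms(4) e(2)]
        insert e(1) by auto
  qed
  then show "in_class (utter_graph G) C"
    using utter_part_uedges[of G] by (metis order_refl)
next
  interpret pair_graph G by fact
  assume "in_class (utter_graph G) C"
  then obtain H where H: "H \<in> C" "graph_iso (utter_graph G) H"
    by (auto simp: in_class_def)
  then obtain f where f: "inj_on f (pverts (utter_graph G))"
    "pverts H = f ` pverts (utter_graph G)" "parcs H = map_prod f f ` parcs (utter_graph G)"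
    using graph_iso_iff[OF pair_wf_utter_part[of G "uedges G"], of H]
    unfolding utter_part_uedges by auto
  interpret H: pair_graph H
    using assms(1) H by (auto simp: graph_class_def)
  \<comment> \<open>The vertices of the copy \<open>H\<close> that stand for edges of
    \<open>G\<close>; deleting them leaves a copy of \<open>G\<close>, with
    \<open>f \<circ> Inl\<close> as isomorphism.\<close>
  define D where "D = f ` Inr ` uedges G"
  have "D \<subseteq> pverts H"
    unfolding D_def f(2) by (auto simp: utter_graph_def Let_def)
  then have K: "\<lparr> pverts = pverts H - D, parcs = parcs H \<inter> (- D) \<times> (- D) \<rparr> \<in> C" (is "?K \<in> C")
    using induced_subgraph_in_class[OF assms(2) H(1)]
      finite_subset[OF _ H.pair_finite_verts] by auto
  have wf: "u \<in> pverts G" "v \<in> pverts G" "u \<noteq> v" if "(u, v) \<in> parcs G" for u v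
    using that in_arcsD1 in_arcsD2 no_loops' by blast+
  have V: "pverts (utter_graph G) = Inl ` pverts G \<union> Inr ` uedges G"
    by (auto simp: utter_graph_def Let_def)
  have inD: "f z \<in> D \<longleftrightarrow> z \<in> Inr ` uedges G" if "z \<in> pverts (utter_graph G)" for z
    unfolding D_def by (rule inj_on_image_mem_iff[OF f(1) that]) (auto simp: V)
  have "graph_iso G ?K"
    unfolding graph_iso_iff[OF pair_wf_digraph_axioms]
  proof (intro exI[of _ "f \<circ> Inl"] conjI)
    show "inj_on (f \<circ> Inl) (pverts G)"
      using f(1) by (auto simp: V inj_on_def)
    show "pverts ?K = (f \<circ> Inl) ` pverts G"
      using inD by (auto simp: f(2) V)
    have "parcs H \<inter> (- D) \<times> (- D) =
        map_prod f f ` {(a, b) \<in> parcs (utter_graph G). f a \<notin> D \<and> f b \<notin> D}"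
      unfolding f(3) by auto
    also have "{(a, b) \<in> parcs (utter_graph G). f a \<notin> D \<and> f b \<notin> D} =
        {(a, b). a \<in> Inl ` pverts G \<and> b \<in> Inl ` pverts G \<and> a \<noteq> b \<and> utter_adj G a b}"
      using inD by (auto simp: utter_graph_def Let_def)
    \<comment> \<open>On original vertices \<open>utter_adj\<close> is adjacency in
      \<open>G\<close>, and distinctness is automatic because \<open>G\<close> has no loops.\<close>
    also have "\<dots> = map_prod Inl Inl ` parcs G"
      by (auto dest: wf)
    finally show "parcs ?K = map_prod (f \<circ> Inl) (f \<circ> Inl) ` parcs G"
      by (simp add: image_comp map_prod.comp)
  qed
  then show "in_class G C"
    using K by (auto simp: in_class_def)
qed

end
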